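(* Let $k\ge 1$ be an integer. The $k$-order Myerson-Taylor index $(f,G)\mapsto (\Psi^k_S(f,G))_{S}$ is the unique $k$-order interaction index that satisfies the five axioms Linearity (L), Restricted Null Player (RNP), Coalitional Fairness (CF), Interaction Distribution (ID) and Component Efficiency (CE). That is, $\Psi^k$ satisfies these five axioms, and if $\mathcal I^k$ is any $k$-order interaction index satisfying L, RNP, CF, ID and CE, then $\mathcal I^k_S(f,G)=\Psi^k_S(f,G)$ for every graph $G=(V,E)$, every $f:2^V\to\mathbb R$, and every $S\subseteq V$ with $|S|\le k$.
   Context: Graphs $G=(V,E)$ are finite, simple, undirected, with $V\neq\emptyset$. For $T\subseteq V$, $\zeta(T)$ denotes the set of (vertex sets of) connected components of the subgraph of $G$ induced by $T$ (so $\zeta(\emptyset)=\emptyset$); $T$ is called connected if $|\zeta(T)|=1$. We write $f(i)$ for $f(\{i\})$ and $T\cup i$ for $T\cup\{i\}$. Functions (models) are arbitrary $f:2^V\to\mathbb R$. The interaction-restricted function is $f|_E(T)=\sum_{R\in\zeta(T)}f(R)$. For a function $h:2^V\to\mathbb R$ and $S,T\subseteq V$, $\delta_S h(T)=\sum_{W\subseteq S}(-1)^{|S|-|W|}h(W\cup T)$. A $k$-order interaction index $\mathcal I^k$ assigns to each graph $G=(V,E)$, each function $f:2^V\to\mathbb R$, and each $S\subseteq V$ with $|S|\le k$, a real number $\mathcal I^k_S(f,G)$. The $k$-order Myerson-Taylor index is, for $S\subseteq V$, $|S|\le k$, $$\Psi^k_S(f,G)=\begin{cases}\delta_S f|_E(\emptyset)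 & |S|<k,\\ \dfrac{k}{|V|}\displaystyle\sum_{T\subseteq V\setminus S}\dfrac{1}{\binom{|V|-1}{|T|}}\,\delta_S f|_E(T) & |S|=k.\end{cases}$$ Axioms for an index $\mathcal I^k$: (L) For all $G$, all $f_1,f_2$, and all constants $\alpha$: $\mathcal I^k(f_1+\alpha f_2,G)=\mathcal I^k(f_1,G)+\alpha\,\mathcal I^k(f_2,G)$, where $(f_1+\alpha f_2)(T)=f_1(T)+\alpha f_2(T)$ for all $T\subseteq V$. (RNP) A node $i\in V$ is a restricted null player for $(f,G)$ if $f(T\cup i)=\sum_{R\in\zeta(T)}f(R)+f(i)$ for every $T\subseteq V\setminus\{i\}$ such that $T\cup i$ is connected. For every such $i$: (i) $\mathcal I^k_{\{i\}}(f,G)=f(i)$; (ii) $\mathcal I^k_{S\cup i}(f,G)=0$ for every nonempty $S\subseteq V\setminus\{i\}$ with $|S\cup i|\le k$. (CF) For every $G$, every connected $T\subseteq V$ and all $f_1,f_2$ with $f_1(R)=f_2(R)$ for all $R\ne T$: $\mathcal I^k_{S_1}(f_1,G)-\mathcal I^k_{S_1}(f_2,G)=\mathcal I^k_{S_2}(f_1,G)-\mathcal I^k_{S_2}(f_2,G)$ for all $S_1,S_2\subseteq T$ with $|S_1|=|S_2|$ (of size at most $k$, so that the index is defined). (ID) For every $G$ and connected $T\subseteq V$, with unanimity function $u_T(S)=1$ if $S\supseteq T$ and $u_T(S)=0$ otherwise: $\mathcal I^k_S(u_T,G)=0$ for all $S\subsetneq T$ with $|S|<k$. (CE) For every $G$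 and $f$: $\sum_{S\subseteq C,\,|S|\le k}\mathcal I^k_S(f,G)=f(C)-f(\emptyset)$ for every $C\in\zeta(V)$.
   Formalization: Proved for f with f(∅)=0, since Ψ ignores f(∅) and violates CE when f(∅)≠0; for arbitrary f, Ψ is shown to satisfy L, RNP, CF and ID, and any index satisfying all five axioms equals Ψ except at S=∅ when f(∅)≠0. *)

theory Defs
  imports Complex_Main "Graph_Theory.Digraph_Component"
begin

text \<open>
  A finite simple undirected graph is modelled, as in the AFP entry \<open>Graph_Theory\<close>, by a finite
  symmetric loop-free relation \<open>parcs G\<close> on the vertex set \<open>pverts G\<close> (locale \<open>pair_graph\<close>).
  That locale admits the empty graph, which is excluded here.
\<close>

definition simple_graph :: "'a pair_pre_digraph \<Rightarrow> bool" where
  "simple_graph G \<longleftrightarrow> pair_graph G \<and> pverts G \<noteq> {}"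

text \<open>
  In a symmetric digraph the strongly connected components are the connected components of
  the underlying undirected graph; \<open>sccs_verts\<close> consists of nonempty sets, so there are
  none for \<open>T = {}\<close>.
\<close>

definition components :: "'a pair_pre_digraph \<Rightarrow> 'a set \<Rightarrow> 'a set set" where
  "components G T = pre_digraph.sccs_verts (with_proj G \<restriction> T)"

definition connected_in :: "'a pair_pre_digraph \<Rightarrow> 'a set \<Rightarrow> bool" where
  "connected_in G T \<longleftrightarrow> card (components G T) = 1"

definition restrict_fun :: "'a pair_pre_digraph \<Rightarrow> ('a set \<Rightarrow> real) \<Rightarrow> 'a set \<Rightarrow> real" where
  "restrict_fun G f T = (\<Sum>R\<in>components G T. f R)"

definition discrete_deriv :: "'a set \<Rightarrow> ('a set \<Rightarrow> real) \<Rightarrow> 'a set \<Rightarrow> real" where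
  "discrete_deriv S h T = (\<Sum>W\<in>Pow S. (-1) ^ (card S - card W) * h (W \<union> T))"

text \<open>
  An index maps \<open>S\<close>, \<open>f\<close>, \<open>G\<close> to a real number. Only the arguments with \<open>simple_graph G\<close>,
  \<open>S \<subseteq> pverts G\<close> and \<open>card S \<le> k\<close> matter.
\<close>

type_synonym 'a index = "'a set \<Rightarrow> ('a set \<Rightarrow> real) \<Rightarrow> 'a pair_pre_digraph \<Rightarrow> real"

definition myerson_taylor :: "nat \<Rightarrow> 'a index" where
  "myerson_taylor k S f G =
     (if card S < k then discrete_deriv S (restrict_fun G f) {}
      else real k / real (card (pverts G)) *
        (\<Sum>T\<in>Pow (pverts G - S).
           1 / real ((card (pverts G) - 1) choose card T) *
             discrete_deriv S (restrict_fun G f) T))"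

text \<open>
  The axioms are relative to a class \<open>M\<close> of models, either \<open>UNIV\<close> (arbitrary functions) or
  \<open>normalized\<close> below.

  A function on the subsets of \<open>pverts G\<close> is represented by a total function on \<open>'a set\<close>;
  the next condition says that the index only depends on the represented function.
\<close>

definition interaction_index :: "('a set \<Rightarrow> real) set \<Rightarrow> nat \<Rightarrow> 'a index \<Rightarrow> bool" where
  "interaction_index M k I \<longleftrightarrow>
     (\<forall>G. simple_graph G \<longrightarrow> (\<forall>f\<in>M. \<forall>g\<in>M. (\<forall>T\<subseteq>pverts G. f T = g T) \<longrightarrow>
        (\<forall>S\<subseteq>pverts G. card S \<le> k \<longrightarrow> I S f G = I S g G)))"

definition linearity :: "('a set \<Rightarrow> real) set \<Rightarrow> nat \<Rightarrow> 'a index \<Rightarrow> bool" where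
  "linearity M k I \<longleftrightarrow>
     (\<forall>G. simple_graph G \<longrightarrow> (\<forall>f1\<in>M. \<forall>f2\<in>M. \<forall>\<alpha>. \<forall>S\<subseteq>pverts G. card S \<le> k \<longrightarrow>
        I S (\<lambda>T. f1 T + \<alpha> * f2 T) G = I S f1 G + \<alpha> * I S f2 G))"

definition restricted_null_player ::
    "'a pair_pre_digraph \<Rightarrow> ('a set \<Rightarrow> real) \<Rightarrow> 'a \<Rightarrow> bool" where
  "restricted_null_player G f i \<longleftrightarrow> i \<in> pverts G \<and>
     (\<forall>T\<subseteq>pverts G - {i}. connected_in G (insert i T) \<longrightarrow>
        f (insert i T) = (\<Sum>R\<in>components G T. f R) + f {i})"

definition restricted_null_player_axiom ::
    "('a set \<Rightarrow> real) set \<Rightarrow> nat \<Rightarrow> 'a index \<Rightarrow> bool" where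
  "restricted_null_player_axiom M k I \<longleftrightarrow>
     (\<forall>G. simple_graph G \<longrightarrow> (\<forall>f\<in>M. \<forall>i. restricted_null_player G f i \<longrightarrow>
        I {i} f G = f {i} \<and>
        (\<forall>S\<subseteq>pverts G - {i}. S \<noteq> {} \<longrightarrow> card (insert i S) \<le> k \<longrightarrow> I (insert i S) f G = 0)))"

definition coalitional_fairness :: "('a set \<Rightarrow> real) set \<Rightarrow> nat \<Rightarrow> 'a index \<Rightarrow> bool" where
  "coalitional_fairness M k I \<longleftrightarrow>
     (\<forall>G. simple_graph G \<longrightarrow> (\<forall>T\<subseteq>pverts G. connected_in G T \<longrightarrow>
        (\<forall>f1\<in>M. \<forall>f2\<in>M. (\<forall>R\<subseteq>pverts G. R \<noteq> T \<longrightarrow> f1 R = f2 R) \<longrightarrow>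
           (\<forall>S1\<subseteq>T. \<forall>S2\<subseteq>T. card S1 = card S2 \<longrightarrow> card S1 \<le> k \<longrightarrow>
              I S1 f1 G - I S1 f2 G = I S2 f1 G - I S2 f2 G))))"

definition unanimity :: "'a set \<Rightarrow> 'a set \<Rightarrow> real" where
  "unanimity T S = (if T \<subseteq> S then 1 else 0)"

text \<open>No class of models here: \<open>unanimity T {} = 0\<close>, since a connected \<open>T\<close> is nonempty.\<close>

definition interaction_distribution :: "nat \<Rightarrow> 'a index \<Rightarrow> bool" where
  "interaction_distribution k I \<longleftrightarrow>
     (\<forall>G. simple_graph G \<longrightarrow> (\<forall>T\<subseteq>pverts G. connected_in G T \<longrightarrow>
        (\<forall>S. S \<subset> T \<longrightarrow> card S < k \<longrightarrow> I S (unanimity T) G = 0)))"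

definition component_efficiency :: "('a set \<Rightarrow> real) set \<Rightarrow> nat \<Rightarrow> 'a index \<Rightarrow> bool" where
  "component_efficiency M k I \<longleftrightarrow>
     (\<forall>G. simple_graph G \<longrightarrow> (\<forall>f\<in>M. \<forall>C\<in>components G (pverts G).
        (\<Sum>S | S \<subseteq> C \<and> card S \<le> k. I S f G) = f C - f {}))"

definition satisfies_axioms :: "('a set \<Rightarrow> real) set \<Rightarrow> nat \<Rightarrow> 'a index \<Rightarrow> bool" where
  "satisfies_axioms M k I \<longleftrightarrow>
     interaction_index M k I \<and> linearity M k I \<and> restricted_null_player_axiom M k I \<and>
     coalitional_fairness M k I \<and> interaction_distribution k I \<and> component_efficiency M k I"

text \<open>
  The Myerson-Taylor index never uses the value \<open>f {}\<close>, because \<open>components G {} = {}\<close>, whereas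
  component efficiency does. Hence it violates component efficiency as soon as \<open>f {} \<noteq> 0\<close>
  (see the lemma), and the characterization needs the usual normalization of cooperative
  games.
\<close>

definition normalized :: "('a set \<Rightarrow> real) set" where
  "normalized = {f. f {} = 0}"

lemma not_component_efficiency_myerson_taylor:
  "\<not> component_efficiency UNIV k (myerson_taylor k :: 'a index)"
proof
  assume ce: "component_efficiency UNIV k (myerson_taylor k :: 'a index)"
  define a :: 'a where "a = undefined"
  define G :: "'a pair_pre_digraph" where "G = \<lparr>pverts = {a}, parcs = {}\<rparr>"
  define f :: "'a set \<Rightarrow> real" where "f = (\<lambda>S. if S = {} then 1 else 0)"
  have "pair_graph G"
    by unfold_locales (auto simp: G_def symmetric_def arcs_ends_def sym_def)
  then have G: "simple_graph G"
    by (simp add: simple_graph_def G_def)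
  have "restrict_fun G f T = 0" for T
    unfolding restrict_fun_def components_def
    by (rule sum.neutral) (auto simp: f_def pre_digraph.sccs_verts_def)
  then have "discrete_deriv S (restrict_fun G f) T = 0" for S T
    by (simp add: discrete_deriv_def)
  then have zero: "myerson_taylor k S f G = 0" for S
    by (simp add: myerson_taylor_def)
  have reach: "u \<rightarrow>\<^sup>*\<^bsub>with_proj G \<restriction> {a}\<^esub> v \<longleftrightarrow> u = a \<and> v = a" for u v
    unfolding reachable_def
    by (auto simp: G_def arcs_ends_def elim: rtrancl_on.cases)
  have "{a} \<in> components G (pverts G)"
    unfolding components_def pre_digraph.sccs_verts_def using reach by (auto simp: G_def)
  then have "(\<Sum>S | S \<subseteq> {a} \<and> card S \<le> k. myerson_taylor k S f G) = f {a} - f {}"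
    using ce G unfolding component_efficiency_def by blast
  then show False
    unfolding zero by (simp add: f_def)
qed

end

theory Submission
  imports Defs
begin

text \<open>
  Let \<open>h = restrict_fun G f\<close>. Its Harsanyi dividends \<open>a T = discrete_deriv T h {}\<close> satisfy
  \<open>h W = (\<Sum>T\<in>Pow W. a T)\<close>. Below order \<open>k\<close> the index is \<open>a S\<close>, and at order \<open>k\<close> a beta-integral
  identity turns it into the sum of \<open>a T / (card T choose k)\<close> over \<open>T \<supseteq> S\<close>: every dividend is split
  equally among the subsets of size \<open>k\<close>. A dividend vanishes if \<open>T\<close> meets a component without
  being contained in it, or if \<open>T\<close> is not a singleton and contains a restricted null player;
  this gives efficiency and the null player axiom.

  For uniqueness, consider the difference \<open>D\<close> of two indices. If \<open>f\<close> vanishes on all connected sets,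
  then every vertex is a restricted null player, so \<open>D\<close> vanishes at \<open>f\<close>. By linearity it remains to
  treat the indicator functions of connected sets \<open>T\<close>, by induction downwards from the largest ones.
  Up to indicator functions already treated and to functions vanishing on connected sets, the
  indicator function of \<open>T\<close> is \<open>unanimity T\<close>. For the latter, all vertices outside \<open>T\<close> are null, the
  distribution axiom kills all but the largest admissible subsets of \<open>T\<close>, fairness makes these equal,
  and efficiency makes their sum zero.
\<close>

section \<open>Components of induced subgraphs\<close>

text \<open>Reachability inside \<open>T\<close>. With \<open>rtrancl_on\<close> it is reflexive on
  \<open>T\<close> only, so for a symmetric graph it is an equivalence on \<open>T\<close>.\<close>

definition linked :: "'a pair_pre_digraph \<Rightarrow> 'a set \<Rightarrow> 'a rel" where
  "linked G T = rtrancl_on T (Restr (parcs G) T)"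

lemma reachable_induce_subgraph_iff:
  "u \<rightarrow>\<^sup>*\<^bsub>with_proj G \<restriction> T\<^esub> v \<longleftrightarrow> (u, v) \<in> linked G T"
proof -
  have "arcs_ends (with_proj G \<restriction> T) = Restr (parcs G) T"
    by (force simp: arcs_ends_def arc_to_ends_def)
  then show ?thesis
    by (simp add: reachable_def linked_def)
qed

lemma sym_parcs: "pair_graph G \<Longrightarrow> sym (parcs G)"
  using pair_sym_digraph.pair_sym_arcs[of G]
  by (auto simp: pair_graph_def pair_pseudo_graph_def symmetric_def)

lemma simple_graph_finite_pverts: "simple_graph G \<Longrightarrow> finite (pverts G)"
  by (auto simp: simple_graph_def pair_graph_def pair_digraph_def
      intro: pair_fin_digraph.pair_finite_verts)

lemma linked_in: "(u, v) \<in> linked G T \<Longrightarrow> u \<in> T \<and> v \<in> T"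
  unfolding linked_def by (auto dest: in_rtrancl_on_in_F)

lemma equiv_linked:
  assumes "sym (parcs G)"
  shows "equiv T (linked G T)"
proof (rule equivI)
  show "linked G T \<subseteq> T \<times> T"
    by (auto dest: linked_in)
  show "refl_on T (linked G T)"
    by (auto simp: refl_on_def linked_def)
  have "sym (Restr (parcs G) T)"
    using assms by (auto simp: sym_def)
  then show "sym (linked G T)"
    unfolding linked_def by (rule rtrancl_on_sym)
  show "trans (linked G T)"
    unfolding linked_def by (auto intro!: transI elim: rtrancl_on_trans)
qed

lemma linked_mono:
  assumes "T \<subseteq> U"
  shows "linked G T \<subseteq> linked G U"
proof -
  have "(u, v) \<in> rtrancl_on U (Restr (parcs G) U)" if "(u, v) \<in> rtrancl_on T (Restr (parcs G) T)" for u v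
    using that
  proof (induction rule: rtrancl_on_induct)
    case base
    then show ?case using assms by blast
  next
    case (step y z)
    then show ?case using assms by (blast intro: rtrancl_on_into_rtrancl_on)
  qed
  then show ?thesis by (auto simp: linked_def)
qed

text \<open>Components are defined as maximal sets of mutually reachable vertices; by symmetry these
  are equivalence classes, so facts on quotients apply.\<close>

lemma components_eq_quotient:
  assumes "sym (parcs G)"
  shows "components G T = T // linked G T"
proof -
  note eq = equiv_linked[OF assms, of T]
  have "R \<in> components G T \<longleftrightarrow> R \<noteq> {} \<and> (\<forall>u\<in>R. \<forall>v\<in>R. (u, v) \<in> linked G T) \<and>
    (\<forall>u\<in>R. \<forall>v. v \<notin> R \<longrightarrow> (u, v) \<notin> linked G T \<or> (v, u) \<notin> linked G T)" for R
    unfolding components_def pre_digraph.sccs_verts_def reachable_induce_subgraph_iff by blast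
  moreover have "R \<in> T // linked G T \<longleftrightarrow> R \<noteq> {} \<and> (\<forall>u\<in>R. \<forall>v\<in>R. (u, v) \<in> linked G T) \<and>
    (\<forall>u\<in>R. \<forall>v. v \<notin> R \<longrightarrow> (u, v) \<notin> linked G T \<or> (v, u) \<notin> linked G T)" (is "_ \<longleftrightarrow> ?c") for R
  proof
    assume R: "R \<in> T // linked G T"
    then show ?c
      using in_quotient_imp_non_empty[OF eq R] in_quotient_imp_in_rel[OF eq R]
        in_quotient_imp_closed[OF eq R] by blast
  next
    assume c: ?c
    then obtain u where u: "u \<in> R" by blast
    have "R = linked G T `` {u}"
      using c u eq unfolding equiv_def sym_def by blast
    moreover have "u \<in> T"
      using c u linked_in by metis
    ultimately show "R \<in> T // linked G T"
      by (simp add: quotientI)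
  qed
  ultimately show ?thesis by (intro set_eqI) (simp only:)
qed

lemma Union_components: "sym (parcs G) \<Longrightarrow> \<Union> (components G T) = T"
  by (simp add: components_eq_quotient Union_quotient equiv_linked)

lemma component_subset: "\<lbrakk>sym (parcs G); R \<in> components G T\<rbrakk> \<Longrightarrow> R \<subseteq> T"
  using Union_components by blast

lemma component_nonempty: "R \<in> components G T \<Longrightarrow> R \<noteq> {}"
  by (auto simp: components_def pre_digraph.sccs_verts_def)

lemma finite_components:
  assumes "sym (parcs G)" "finite T"
  shows "finite (components G T)"
  by (rule finite_subset[of _ "Pow T"]) (use assms component_subset in blast)+

lemma components_disjoint:
  assumes "sym (parcs G)" "R \<in> components G T" "R' \<in> components G T"
  shows "R = R' \<or> R \<inter> R' = {}"
  using quotient_disj[OF equiv_linked[OF assms(1)]] assms(2,3)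
  unfolding components_eq_quotient[OF assms(1)] by blast

lemma components_empty [simp]: "sym (parcs G) \<Longrightarrow> components G {} = {}"
  by (simp add: components_eq_quotient quotient_def)

section \<open>Connected sets and separated unions\<close>

lemma connected_in_iff:
  assumes "sym (parcs G)"
  shows "connected_in G T \<longleftrightarrow> components G T = {T}"
  using Union_components[OF assms, of T] by (auto simp: connected_in_def card_1_singleton_iff)

lemma connected_in_nonempty: "\<lbrakk>sym (parcs G); connected_in G T\<rbrakk> \<Longrightarrow> T \<noteq> {}"
  by (auto simp: connected_in_def)

lemma connected_in_singleton: "sym (parcs G) \<Longrightarrow> connected_in G {i}"
proof -
  assume G: "sym (parcs G)"
  have R: "R = {i}" if "R \<in> components G {i}" for R
    using component_subset[OF G that] component_nonempty[OF that] by (simp add: subset_singleton_iff)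
  moreover have "components G {i} \<noteq> {}"
    using Union_components[OF G, of "{i}"] by auto
  ultimately have "components G {i} = {{i}}" by (auto simp: set_eq_iff[of _ "{{i}}"])
  then show ?thesis by (simp add: connected_in_iff[OF G])
qed

text \<open>By monotonicity of \<open>linked\<close>, the single class of \<open>X\<close> lies
  within one class of the larger set \<open>T\<close>.\<close>

lemma connected_in_subset_component:
  assumes G: "sym (parcs G)" and "connected_in G X" "X \<subseteq> T"
  obtains R where "R \<in> components G T" "X \<subseteq> R"
proof -
  note eq = equiv_linked[OF G]
  have X: "X \<in> X // linked G X"
    using assms by (simp add: connected_in_iff components_eq_quotient)
  obtain x where x: "x \<in> X"
    using connected_in_nonempty[OF G assms(2)] by blast
  have "X \<subseteq> linked G T `` {x}"
    using in_quotient_imp_in_rel[OF eq X] x linked_mono[OF assms(3), of G] by blast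
  moreover have "linked G T `` {x} \<in> components G T"
    using x assms(3) by (auto simp: components_eq_quotient[OF G] intro: quotientI)
  ultimately show ?thesis using that by blast
qed

text \<open>Without arcs from \<open>A\<close> to \<open>B\<close>, a path that starts in
  \<open>A\<close> never leaves \<open>A\<close>.\<close>

lemma linked_Un_image:
  assumes "x \<in> A" and sep: "\<And>a b. \<lbrakk>a \<in> A; b \<in> B\<rbrakk> \<Longrightarrow> (a, b) \<notin> parcs G"
  shows "linked G (A \<union> B) `` {x} = linked G A `` {x}"
proof -
  have "(x, y) \<in> linked G A" if "(x, y) \<in> linked G (A \<union> B)" for y
    using that unfolding linked_def
  proof (induction rule: rtrancl_on_induct)
    case base
    then show ?case using assms(1) by simp
  next
    case (step y z)
    then have "y \<in> A" "(y, z) \<in> parcs G" "z \<in> A \<union> B"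
      by (auto dest: in_rtrancl_on_in_F)
    then have "(y, z) \<in> Restr (parcs G) A" "z \<in> A"
      using sep by blast+
    then show ?case
      using step.IH by (blast intro: rtrancl_on_into_rtrancl_on)
  qed
  then show ?thesis
    using linked_mono[of A "A \<union> B" G] by blast
qed

lemma components_Un:
  assumes G: "sym (parcs G)" and sep: "\<And>a b. \<lbrakk>a \<in> A; b \<in> B\<rbrakk> \<Longrightarrow> (a, b) \<notin> parcs G"
  shows "components G (A \<union> B) = components G A \<union> components G B"
proof -
  have "(b, a) \<notin> parcs G" if "a \<in> A" "b \<in> B" for a b
    using sep[OF that] G by (auto dest: symD)
  then have "linked G (A \<union> B) `` {x} = linked G B `` {x}" if "x \<in> B" for x
    using linked_Un_image[of x B A G] that by (simp add: Un_commute)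
  then show ?thesis
    using linked_Un_image[of _ A B G] sep
    by (simp add: components_eq_quotient[OF G] quotient_def)
qed

lemma component_no_arcs:
  assumes G: "sym (parcs G)" and C: "C \<in> components G T" and "u \<in> C" "v \<in> T - C"
  shows "(u, v) \<notin> parcs G"
proof
  assume "(u, v) \<in> parcs G"
  moreover have "u \<in> T"
    using assms component_subset by blast
  ultimately have "(u, v) \<in> linked G T"
    using assms(4) unfolding linked_def by (auto intro: rtrancl_on_into_rtrancl_on)
  then have "v \<in> C"
    using in_quotient_imp_closed[OF equiv_linked[OF G]] C assms(3)
    by (auto simp: components_eq_quotient[OF G])
  then show False using assms(4) by simp
qed

text \<open>No arcs join \<open>C\<close> and \<open>T - C\<close>, so \<open>C\<close> is a
  component of one of these two parts, hence of \<open>C\<close> itself; any other component of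
  \<open>C\<close> would have to be disjoint from it.\<close>

lemma component_connected:
  assumes G: "sym (parcs G)" and C: "C \<in> components G T"
  shows "connected_in G C"
proof -
  have "components G (C \<union> (T - C)) = components G C \<union> components G (T - C)"
    using component_no_arcs[OF assms] by (intro components_Un G) auto
  moreover have "C \<union> (T - C) = T"
    using component_subset[OF assms] by blast
  ultimately have "C \<in> components G C \<union> components G (T - C)"
    using C by simp
  moreover have "C \<notin> components G (T - C)"
    using component_subset[OF G] component_nonempty[OF C] by blast
  ultimately have C': "C \<in> components G C" by simp
  have "R = C" if "R \<in> components G C" for R
    using components_disjoint[OF G that C'] component_subset[OF G that]
      component_nonempty[OF that] by blast
  then show ?thesis
    using C' by (auto simp: connected_in_iff[OF G])
qed

section \<open>The interaction-restricted function\<close>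

lemma restrict_fun_connected: "\<lbrakk>sym (parcs G); connected_in G T\<rbrakk> \<Longrightarrow> restrict_fun G f T = f T"
  by (simp add: restrict_fun_def connected_in_iff)

lemma restrict_fun_cong:
  assumes G: "sym (parcs G)"
    and "\<And>R. \<lbrakk>R \<subseteq> T; connected_in G R\<rbrakk> \<Longrightarrow> f R = g R"
  shows "restrict_fun G f T = restrict_fun G g T"
  unfolding restrict_fun_def
  by (rule sum.cong) (auto intro: assms component_connected[OF G] dest: component_subset[OF G])

lemma restrict_fun_linear:
  "restrict_fun G (\<lambda>T. f T + \<alpha> * g T) T = restrict_fun G f T + \<alpha> * restrict_fun G g T"
  by (simp add: restrict_fun_def sum.distrib sum_distrib_left)

lemma restrict_fun_Un:
  assumes G: "sym (parcs G)" and sep: "\<And>a b. \<lbrakk>a \<in> A; b \<in> B\<rbrakk> \<Longrightarrow> (a, b) \<notin> parcs G"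
    and "finite A" "finite B" "A \<inter> B = {}"
  shows "restrict_fun G f (A \<union> B) = restrict_fun G f A + restrict_fun G f B"
proof -
  have "components G A \<inter> components G B = {}"
    using component_subset[OF G] component_nonempty[of _ G] assms(5) by blast
  then show ?thesis
    using assms by (simp add: restrict_fun_def components_Un sum.union_disjoint finite_components)
qed

lemma restrict_fun_split_component:
  assumes G: "sym (parcs G)" and C: "C \<in> components G V" and "finite V" "T \<subseteq> V"
  shows "restrict_fun G f T = restrict_fun G f (T \<inter> C) + restrict_fun G f (T - C)"
proof -
  have "restrict_fun G f ((T \<inter> C) \<union> (T - C)) =
      restrict_fun G f (T \<inter> C) + restrict_fun G f (T - C)"
    using assms component_no_arcs[OF G C]
    by (intro restrict_fun_Un) (auto intro: finite_subset)
  moreover have "(T \<inter> C) \<union> (T - C) = T" by blast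
  ultimately show ?thesis by simp
qed

text \<open>The null player condition covers connected coalitions only. It extends to all because
  \<open>i\<close> affects just its own component \<open>C\<close>, and the rest of \<open>T\<close>
  contributes the same with and without \<open>i\<close>.\<close>

lemma restrict_fun_null_player:
  assumes G: "sym (parcs G)" and V: "finite (pverts G)"
    and null: "restricted_null_player G f i" and T: "T \<subseteq> pverts G - {i}"
  shows "restrict_fun G f (insert i T) = restrict_fun G f T + f {i}"
proof -
  let ?U = "insert i T"
  obtain C where C: "C \<in> components G ?U" and i: "i \<in> C"
    using Union_components[OF G, of ?U] by blast
  define Q where "Q = C - {i}"
  have CQ: "C = insert i Q" using i by (auto simp: Q_def)
  have sub: "Q \<subseteq> T" using component_subset[OF G C] by (auto simp: Q_def)
  have fin: "finite T" using T V by (meson Diff_subset finite_subset)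
  have no: "(a, b) \<notin> parcs G" if "a \<in> C" "b \<in> T - Q" for a b
    using component_no_arcs[OF G C, of a b] that T by (auto simp: CQ)
  have "restrict_fun G f (C \<union> (T - Q)) = restrict_fun G f C + restrict_fun G f (T - Q)"
    using fin T sub by (intro restrict_fun_Un G no) (auto simp: CQ intro: finite_subset)
  moreover have "C \<union> (T - Q) = ?U" using sub CQ by blast
  moreover have con: "connected_in G C" by (rule component_connected[OF G C])
  moreover have "restrict_fun G f C = f C" by (rule restrict_fun_connected[OF G con])
  moreover have "f C = restrict_fun G f Q + f {i}"
    using null sub T con by (auto simp: restricted_null_player_def restrict_fun_def CQ)
  moreover have "restrict_fun G f (Q \<union> (T - Q)) = restrict_fun G f Q + restrict_fun G f (T - Q)"
    using fin sub no by (intro restrict_fun_Un G) (auto simp: CQ intro: finite_subset)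
  moreover have "Q \<union> (T - Q) = T" using sub by blast
  ultimately show ?thesis by simp
qed

section \<open>Discrete derivatives\<close>

lemma sum_Pow_insert:
  assumes "finite S" "i \<notin> S"
  shows "(\<Sum>W\<in>Pow (insert i S). F W) = (\<Sum>W\<in>Pow S. F W + F (insert i W) :: real)"
proof -
  have "inj_on (insert i) (Pow S)"
    using assms(2) by (auto simp: inj_on_def dest!: insert_ident[THEN iffD1, rotated 2])
  moreover have "Pow S \<inter> insert i ` Pow S = {}"
    using assms(2) by auto
  ultimately show ?thesis
    using assms(1) by (simp add: Pow_insert sum.union_disjoint sum.reindex sum.distrib)
qed

lemma discrete_deriv_empty [simp]: "discrete_deriv {} h R = h R"
  by (simp add: discrete_deriv_def)

lemma discrete_deriv_cong:
  assumes "\<And>W. W \<subseteq> S \<Longrightarrow> g (W \<union> R) = h (W \<union> R)"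
  shows "discrete_deriv S g R = discrete_deriv S h R"
  using assms by (simp add: discrete_deriv_def)

lemma discrete_deriv_linear:
  "discrete_deriv S (\<lambda>T. g T + \<alpha> * h T) R = discrete_deriv S g R + \<alpha> * discrete_deriv S h R"
  by (simp add: discrete_deriv_def sum_distrib_left flip: sum.distrib)
    (simp add: algebra_simps)

lemma discrete_deriv_insert:
  assumes "finite S" "i \<notin> S"
  shows "discrete_deriv (insert i S) h R = discrete_deriv S (\<lambda>W. h (insert i W) - h W) R"
proof -
  \<comment> \<open>The exponent of the sign is a truncated difference;
    \<open>card W \<le> card S\<close> guarantees that it grows by exactly one when \<open>i\<close>
    joins \<open>S\<close> but not \<open>W\<close>.\<close>
  have *: "finite W" "card W \<le> card S" "i \<notin> W" if "W \<subseteq> S" for W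
    using that assms by (auto intro: finite_subset card_mono)
  show ?thesis
    unfolding discrete_deriv_def sum_Pow_insert[OF assms]
    using assms by (intro sum.cong) (simp_all add: * Suc_diff_le algebra_simps)
qed

lemma discrete_deriv_diff_insert:
  assumes "finite S" "i \<notin> S"
  shows "discrete_deriv S h (insert i R) - discrete_deriv S h R = discrete_deriv (insert i S) h R"
  unfolding discrete_deriv_insert[OF assms]
  by (simp add: discrete_deriv_def algebra_simps sum_subtractf)

lemma discrete_deriv_const:
  assumes "finite S"
  shows "discrete_deriv S (\<lambda>_. c) R = (if S = {} then c else 0)"
proof (cases "S = {}")
  case False
  then obtain i S' where "S = insert i S'" "i \<notin> S'" by (meson equals0I mk_disjoint_insert)
  then show ?thesis
    using assms by (simp add: discrete_deriv_insert) (simp add: discrete_deriv_def)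
qed simp

text \<open>Differentiating in direction \<open>i\<close> first leaves a constant, which further
  derivatives kill. Used with \<open>c = f {i}\<close> for null players and with
  \<open>c = 0\<close> for functions that do not depend on \<open>i\<close>.\<close>

lemma discrete_deriv_increment:
  assumes "finite S" "i \<in> S" and "\<And>W. W \<subseteq> S - {i} \<Longrightarrow> h (insert i W) = h W + c"
  shows "discrete_deriv S h {} = (if S = {i} then c else 0)"
proof -
  have "discrete_deriv (insert i (S - {i})) h {} = discrete_deriv (S - {i}) (\<lambda>_. c) {}"
    using assms by (subst discrete_deriv_insert) (auto intro!: discrete_deriv_cong)
  moreover have "S - {i} = {} \<longleftrightarrow> S = {i}" using assms(2) by blast
  ultimately show ?thesis
    using assms by (simp add: insert_absorb discrete_deriv_const)
qed

text \<open>By \<open>discrete_deriv_diff_insert\<close>, dropping \<open>i\<close> from the base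
  point costs a derivative in direction \<open>i\<close>. Hence the induction hypothesis is needed
  for both \<open>S\<close> and \<open>insert i S\<close>.\<close>

lemma discrete_deriv_expand:
  assumes "finite R" "finite S" "S \<inter> R = {}"
  shows "discrete_deriv S h R = (\<Sum>Q\<in>Pow R. discrete_deriv (S \<union> Q) h {})"
  using assms
proof (induction R arbitrary: S rule: finite_induct)
  case (insert i R)
  have "discrete_deriv S h (insert i R) = discrete_deriv S h R + discrete_deriv (insert i S) h R"
    using discrete_deriv_diff_insert[of S i h R] insert by simp
  also have "\<dots> = (\<Sum>Q\<in>Pow R. discrete_deriv (S \<union> Q) h {}) +
      (\<Sum>Q\<in>Pow R. discrete_deriv (insert i S \<union> Q) h {})"
    using insert by simp
  finally show ?case
    using insert by (simp add: sum_Pow_insert sum.distrib)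
qed simp

text \<open>Moebius inversion on the subset lattice.\<close>

lemma sum_discrete_deriv:
  assumes "finite R"
  shows "(\<Sum>Q\<in>Pow R. discrete_deriv Q h {}) = h R"
  using discrete_deriv_expand[OF assms, of "{}" h] by simp

section \<open>The weights of the index\<close>

text \<open>The value of the Euler integral of \<open>x ^ a * (1 - x) ^ b\<close> over the unit interval.\<close>

definition beta_weight :: "nat \<Rightarrow> nat \<Rightarrow> real" where
  "beta_weight a b = fact a * fact b / fact (a + b + 1)"

text \<open>Corresponds to multiplying the integrand by \<open>x + (1 - x) = 1\<close>.\<close>

lemma beta_weight_rec: "beta_weight (Suc a) b + beta_weight a (Suc b) = beta_weight a b"
  unfolding beta_weight_def by (simp add: divide_simps) (simp add: algebra_simps)

text \<open>Under the integral, \<open>(x + (1 - x)) ^ card M = 1\<close> is expanded over the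
  subsets of \<open>M\<close>; the proof iterates \<open>beta_weight_rec\<close> over the elements
  of \<open>M\<close>.\<close>

lemma sum_beta_weight:
  assumes "finite M"
  shows "(\<Sum>R\<in>Pow M. beta_weight (a + card R) (b + card (M - R))) = beta_weight a b"
  using assms
proof (induction M arbitrary: a b rule: finite_induct)
  case (insert i M)
  have *: "card (insert i M - R) = Suc (card (M - R))" "card (insert i R) = Suc (card R)"
    "insert i M - insert i R = M - R" if "R \<in> Pow M" for R
  proof -
    have "finite R" "i \<notin> R" using that insert by (auto intro: finite_subset)
    then show "card (insert i M - R) = Suc (card (M - R))" "card (insert i R) = Suc (card R)"
      "insert i M - insert i R = M - R"
      using insert by (auto simp: insert_Diff_if)
  qed
  have "(\<Sum>R\<in>Pow (insert i M). beta_weight (a + card R) (b + card (insert i M - R))) =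
      (\<Sum>R\<in>Pow M. beta_weight (a + card R) (Suc b + card (M - R))) +
      (\<Sum>R\<in>Pow M. beta_weight (Suc a + card R) (b + card (M - R)))"
    using insert.hyps by (simp add: sum_Pow_insert * flip: sum.distrib)
  also have "\<dots> = beta_weight a b"
    using beta_weight_rec[of a b] by (simp only: insert.IH)
  finally show ?case .
qed simp

text \<open>Up to the factor \<open>k\<close>, these are the coefficients of the index at order
  \<open>k\<close>.\<close>

lemma beta_weight_binomial:
  assumes "r < n"
  shows "beta_weight r (n - 1 - r) = 1 / (real n * real ((n - 1) choose r))"
proof -
  have "real n * fact (n - 1) = fact n"
    using assms by (simp add: fact_reduce)
  then show ?thesis
    using assms by (simp add: beta_weight_def binomial_fact)
qed

text \<open>Identifies the total weight of the dividend of a coalition of size \<open>k + q\<close>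
  as an equal share among its subsets of size \<open>k\<close>.\<close>

lemma beta_weight_top:
  assumes "1 \<le> k"
  shows "real k * beta_weight q (k - 1) = 1 / real ((k + q) choose k)"
  using assms by (simp add: beta_weight_def binomial_fact fact_reduce[of k] add.commute)

lemma sum_supersets:
  fixes F :: "'a set \<Rightarrow> real"
  assumes "S \<subseteq> V"
  shows "(\<Sum>T | S \<subseteq> T \<and> T \<subseteq> V. F T) = (\<Sum>Q\<in>Pow (V - S). F (S \<union> Q))"
proof (rule sum.reindex_bij_witness[of _ "\<lambda>Q. S \<union> Q" "\<lambda>T. T - S"])
  fix T assume "T \<in> {T. S \<subseteq> T \<and> T \<subseteq> V}"
  then have "S \<union> (T - S) = T" by blast
  then show "S \<union> (T - S) = T" "F (S \<union> (T - S)) = F T" by simp_all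
qed (use assms in auto)

text \<open>Nested pairs are enumerated by the inner set \<open>Q\<close> first, with
  \<open>R\<close> written as \<open>Q \<union> P\<close>.\<close>

lemma sum_Pow_Pow_swap:
  fixes F :: "'a set \<Rightarrow> 'a set \<Rightarrow> real"
  assumes "finite M"
  shows "(\<Sum>R\<in>Pow M. \<Sum>Q\<in>Pow R. F R Q) = (\<Sum>Q\<in>Pow M. \<Sum>P\<in>Pow (M - Q). F (Q \<union> P) Q)"
proof -
  have "(\<Sum>R\<in>Pow M. \<Sum>Q\<in>Pow R. F R Q) = (\<Sum>R\<in>Pow M. \<Sum>Q | Q \<in> Pow M \<and> Q \<subseteq> R. F R Q)"
    by (intro sum.cong) auto
  also have "\<dots> = (\<Sum>Q\<in>Pow M. \<Sum>R | R \<in> Pow M \<and> Q \<subseteq> R. F R Q)"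
    using assms by (intro sum.swap_restrict) auto
  also have "\<dots> = (\<Sum>Q\<in>Pow M. \<Sum>R | Q \<subseteq> R \<and> R \<subseteq> M. F R Q)"
    by (intro sum.cong) auto
  also have "\<dots> = (\<Sum>Q\<in>Pow M. \<Sum>P\<in>Pow (M - Q). F (Q \<union> P) Q)"
    by (intro sum.cong sum_supersets) auto
  finally show ?thesis .
qed

section \<open>The Myerson-Taylor index\<close>

lemma myerson_taylor_low:
  "card S < k \<Longrightarrow> myerson_taylor k S f G = discrete_deriv S (restrict_fun G f) {}"
  by (simp add: myerson_taylor_def)

lemma myerson_taylor_top:
  assumes V: "finite (pverts G)" and S: "S \<subseteq> pverts G" "card S = k" and k: "1 \<le> k"
  shows "myerson_taylor k S f G = real k * (\<Sum>R\<in>Pow (pverts G - S).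
    beta_weight (card R) (card (pverts G) - 1 - card R) * discrete_deriv S (restrict_fun G f) R)"
proof -
  \<comment> \<open>As \<open>k \<ge> 1\<close>, \<open>R\<close> misses an element of
    \<open>S\<close>; the bound keeps \<open>card (pverts G) - 1 - card R\<close> from being
    truncated.\<close>
  have "card R < card (pverts G)" if "R \<in> Pow (pverts G - S)" for R
  proof -
    have "S \<noteq> {}" using S k by auto
    then have "R \<noteq> pverts G" using that S by auto
    then show ?thesis using that V by (intro psubset_card_mono) auto
  qed
  then have "beta_weight (card R) (card (pverts G) - 1 - card R) =
      1 / (real (card (pverts G)) * real ((card (pverts G) - 1) choose card R))"
    if "R \<in> Pow (pverts G - S)" for R
    using that by (intro beta_weight_binomial)
  then show ?thesis
    unfolding myerson_taylor_def sum_distrib_left using S by (simp add: ac_simps)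
qed

text \<open>
  In terms of the Harsanyi dividends \<open>discrete_deriv T (restrict_fun G f) {}\<close>, the dividend of
  \<open>T\<close> is shared equally among the subsets of \<open>T\<close> of size \<open>k\<close>.
\<close>

lemma myerson_taylor_top_dividends:
  assumes V: "finite (pverts G)" and S: "S \<subseteq> pverts G" "card S = k" and k: "1 \<le> k"
  shows "myerson_taylor k S f G =
    (\<Sum>T | S \<subseteq> T \<and> T \<subseteq> pverts G. discrete_deriv T (restrict_fun G f) {} / real (card T choose k))"
proof -
  define M where "M = pverts G - S"
  define n where "n = card (pverts G)"
  define a where "a = (\<lambda>T. discrete_deriv T (restrict_fun G f) {})"
  have fin: "finite M" "finite S" using V S by (auto simp: M_def intro: finite_subset)
  have n: "n = k + card M"
    using card_mono[OF V S(1)] S fin by (simp add: M_def n_def card_Diff_subset)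
  \<comment> \<open>The coefficient of the dividend of \<open>S \<union> Q\<close> once the sums are
    exchanged. Since \<open>n = k + card M\<close>, the second argument of the weight is
    \<open>(k - 1) + card (M - Q - P)\<close>, as \<open>sum_beta_weight\<close> requires.\<close>
  have weight: "real k * (\<Sum>P\<in>Pow (M - Q). beta_weight (card (Q \<union> P)) (n - 1 - card (Q \<union> P))) =
      1 / real (card (S \<union> Q) choose k)" if Q: "Q \<in> Pow M" for Q
  proof -
    have finQ: "finite Q" using Q fin by (auto intro: finite_subset)
    have "card (Q \<union> P) = card Q + card P \<and>
        n - 1 - card (Q \<union> P) = (k - 1) + card (M - Q - P)" if P: "P \<in> Pow (M - Q)" for P
    proof -
      have finP: "finite P" using P fin by (auto intro: finite_subset)
      have "card (Q \<union> P) = card Q + card P"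
        using P finQ finP by (intro card_Un_disjoint) auto
      moreover have "card M = card Q + card (M - Q)" "card (M - Q) = card P + card (M - Q - P)"
        using card_mono[of M Q] card_mono[of "M - Q" P] P Q fin finQ finP
        by (auto simp: card_Diff_subset)
      ultimately show ?thesis using n k by linarith
    qed
    then have "(\<Sum>P\<in>Pow (M - Q). beta_weight (card (Q \<union> P)) (n - 1 - card (Q \<union> P))) =
        (\<Sum>P\<in>Pow (M - Q). beta_weight (card Q + card P) ((k - 1) + card (M - Q - P)))"
      by (intro sum.cong refl arg_cong2[where f = beta_weight]) blast+
    then have "(\<Sum>P\<in>Pow (M - Q). beta_weight (card (Q \<union> P)) (n - 1 - card (Q \<union> P))) =
        beta_weight (card Q) (k - 1)"
      using sum_beta_weight[of "M - Q" "card Q" "k - 1"] fin by simp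
    moreover have "card (S \<union> Q) = k + card Q"
      using Q fin finQ S by (subst card_Un_disjoint) (auto simp: M_def)
    ultimately show ?thesis
      using beta_weight_top[OF k] by simp
  qed
  have "myerson_taylor k S f G =
      real k * (\<Sum>R\<in>Pow M. \<Sum>Q\<in>Pow R. beta_weight (card R) (n - 1 - card R) * a (S \<union> Q))"
    unfolding myerson_taylor_top[OF assms] M_def[symmetric] n_def[symmetric] a_def
    using fin by (intro arg_cong2[where f = "(*)"] sum.cong refl)
      (subst discrete_deriv_expand, auto simp: M_def sum_distrib_left intro: finite_subset)
  also have "\<dots> = (\<Sum>Q\<in>Pow M. a (S \<union> Q) *
      (real k * (\<Sum>P\<in>Pow (M - Q). beta_weight (card (Q \<union> P)) (n - 1 - card (Q \<union> P)))))"
    unfolding sum_Pow_Pow_swap[OF fin(1)] by (simp add: sum_distrib_left sum_distrib_right ac_simps)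
  also have "\<dots> = (\<Sum>Q\<in>Pow M. a (S \<union> Q) / real (card (S \<union> Q) choose k))"
    by (intro sum.cong refl) (simp only: weight, simp)
  also have "\<dots> = (\<Sum>T | S \<subseteq> T \<and> T \<subseteq> pverts G. a T / real (card T choose k))"
    unfolding M_def by (rule sum_supersets[OF S(1), symmetric])
  finally show ?thesis by (simp add: a_def)
qed

section \<open>Verification of the axioms\<close>

lemma myerson_taylor_cong:
  assumes "S \<subseteq> pverts G" and "\<And>T. T \<subseteq> pverts G \<Longrightarrow> restrict_fun G f T = restrict_fun G g T"
  shows "myerson_taylor k S f G = myerson_taylor k S g G"
proof -
  have "discrete_deriv S (restrict_fun G f) T = discrete_deriv S (restrict_fun G g) T"
    if "T \<subseteq> pverts G" for T
    using that assms by (intro discrete_deriv_cong) auto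
  then show ?thesis
    unfolding myerson_taylor_def by (intro if_cong arg_cong2[where f = "(*)"] sum.cong) auto
qed

lemma interaction_index_myerson_taylor: "interaction_index M k (myerson_taylor k)"
  unfolding interaction_index_def
proof (intro allI ballI impI)
  fix G :: "'a pair_pre_digraph" and f g :: "'a set \<Rightarrow> real" and S
  assume "simple_graph G" "\<forall>T\<subseteq>pverts G. f T = g T" "S \<subseteq> pverts G"
  then show "myerson_taylor k S f G = myerson_taylor k S g G"
    by (auto intro!: myerson_taylor_cong restrict_fun_cong sym_parcs simp: simple_graph_def)
qed

lemma myerson_taylor_linear:
  "myerson_taylor k S (\<lambda>T. f T + \<alpha> * g T) G = myerson_taylor k S f G + \<alpha> * myerson_taylor k S g G"
proof -
  have "restrict_fun G (\<lambda>T. f T + \<alpha> * g T) = (\<lambda>T. restrict_fun G f T + \<alpha> * restrict_fun G g T)"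
    by (simp add: fun_eq_iff restrict_fun_linear)
  then show ?thesis
    by (simp add: myerson_taylor_def discrete_deriv_linear distrib_left sum.distrib
        sum_distrib_left ac_simps)
qed

lemma linearity_myerson_taylor: "linearity M k (myerson_taylor k)"
  by (simp add: linearity_def myerson_taylor_linear)

text \<open>A null player adds \<open>f {i}\<close> to every coalition, so among the coalitions
  containing \<open>i\<close> only \<open>{i}\<close> can have a nonzero dividend.\<close>

lemma dividend_null_player:
  assumes G: "sym (parcs G)" "finite (pverts G)" and null: "restricted_null_player G f i"
    and S: "S \<subseteq> pverts G" "i \<in> S"
  shows "discrete_deriv S (restrict_fun G f) {} = (if S = {i} then f {i} else 0)"
proof (rule discrete_deriv_increment)
  show "finite S" using S G by (blast intro: finite_subset)
  show "restrict_fun G f (insert i W) = restrict_fun G f W + f {i}" if "W \<subseteq> S - {i}" for W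
    using that S by (intro restrict_fun_null_player G null) auto
qed (rule S)

lemma myerson_taylor_null_player:
  assumes G: "simple_graph G" and k: "1 \<le> k" and null: "restricted_null_player G f i"
    and S: "S \<subseteq> pverts G" "i \<in> S" "card S \<le> k"
  shows "myerson_taylor k S f G = (if S = {i} then f {i} else 0)"
proof -
  have sym: "sym (parcs G)" and fin: "finite (pverts G)"
    using G by (auto simp: simple_graph_def sym_parcs simple_graph_finite_pverts)
  note a = dividend_null_player[OF sym fin null]
  show ?thesis
  proof (cases "card S < k")
    case True
    then show ?thesis using a S by (simp add: myerson_taylor_low)
  next
    case False
    then have card: "card S = k" using S by simp
    have "myerson_taylor k S f G = (\<Sum>T | S \<subseteq> T \<and> T \<subseteq> pverts G.
        (if T = {i} then f {i} else 0) / real (card T choose k))"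
      unfolding myerson_taylor_top_dividends[OF fin S(1) card k]
      using S(2) by (intro sum.cong refl arg_cong2[where f = "(/)"] a) auto
    also have "\<dots> = (\<Sum>T | S \<subseteq> T \<and> T \<subseteq> pverts G.
        if T = {i} then f {i} / real (card {i} choose k) else 0)"
      by (intro sum.cong) auto
    also have "\<dots> = (if S = {i} then f {i} else 0)"
    proof -
      have "finite {T. S \<subseteq> T \<and> T \<subseteq> pverts G}"
        using fin by (auto intro: finite_subset[of _ "Pow (pverts G)"])
      then have "?thesis \<longleftrightarrow> (if {i} \<in> {T. S \<subseteq> T \<and> T \<subseteq> pverts G} then f {i} / real (card {i} choose k) else 0) =
          (if S = {i} then f {i} else 0)"
        by (simp only: sum.delta)
      moreover have "{i} \<in> {T. S \<subseteq> T \<and> T \<subseteq> pverts G} \<longleftrightarrow> S = {i}" using S by auto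
      \<comment> \<open>At the top order \<open>S = {i}\<close> forces \<open>k = 1\<close>, so this
        dividend is not divided.\<close>
      moreover have "real (card {i} choose k) = 1" if "S = {i}" using that card by auto
      ultimately show ?thesis
        by (cases "S = {i}") (simp_all only: if_True if_False HOL.simp_thms div_by_1)
    qed
    finally show ?thesis .
  qed
qed

lemma restricted_null_player_axiom_myerson_taylor:
  assumes "1 \<le> k"
  shows "restricted_null_player_axiom M k (myerson_taylor k)"
  unfolding restricted_null_player_axiom_def
proof (intro allI ballI impI conjI)
  fix G :: "'a pair_pre_digraph" and f i
  assume G: "simple_graph G" and null: "restricted_null_player G f i"
  then have i: "i \<in> pverts G" by (simp add: restricted_null_player_def)
  then show "myerson_taylor k {i} f G = f {i}"
    using myerson_taylor_null_player[OF G assms null, of "{i}"] assms by simp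
  fix S assume "S \<subseteq> pverts G - {i}" "S \<noteq> {}" "card (insert i S) \<le> k"
  moreover from this have "insert i S \<noteq> {i}" by blast
  ultimately show "myerson_taylor k (insert i S) f G = 0"
    using myerson_taylor_null_player[OF G assms null, of "insert i S"] i by auto
qed

text \<open>The core of fairness. \<open>restrict_fun G f\<close> vanishes off the supersets of
  \<open>T\<close>, so each derivative keeps only the term \<open>W = S\<close>, and the index
  depends on \<open>S \<subseteq> T\<close> only through its size.\<close>

lemma myerson_taylor_single_coalition:
  assumes G: "simple_graph G" and k: "1 \<le> k" and T: "T \<subseteq> pverts G" "connected_in G T"
    and f: "\<And>R. \<lbrakk>R \<subseteq> pverts G; R \<noteq> T\<rbrakk> \<Longrightarrow> f R = 0"
    and S: "S1 \<subseteq> T" "S2 \<subseteq> T" "card S1 = card S2" "card S1 \<le> k"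
  shows "myerson_taylor k S1 f G = myerson_taylor k S2 f G"
proof -
  have sym: "sym (parcs G)" and fin: "finite (pverts G)"
    using G by (auto simp: simple_graph_def sym_parcs simple_graph_finite_pverts)
  have finT: "finite T" using T(1) fin by (rule finite_subset)
  let ?h = "restrict_fun G f"
  have h0: "?h X = 0" if "X \<subseteq> pverts G" "\<not> T \<subseteq> X" for X
  proof -
    have "?h X = restrict_fun G (\<lambda>_. 0) X"
      using that by (intro restrict_fun_cong sym f) auto
    then show ?thesis by (simp add: restrict_fun_def)
  qed
  have deriv: "discrete_deriv S ?h R = ?h (S \<union> R)" if "S \<subseteq> T" "R \<subseteq> pverts G - S" for S R
  proof -
    have finS: "finite S" using that finT by (blast intro: finite_subset)
    have "discrete_deriv S ?h R = (\<Sum>W\<in>Pow S. if W = S then ?h (S \<union> R) else 0)"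
      unfolding discrete_deriv_def
    proof (intro sum.cong refl)
      fix W assume "W \<in> Pow S"
      \<comment> \<open>Some element of \<open>S\<close>, hence of \<open>T\<close>, lies neither in
        \<open>W\<close> nor in \<open>R\<close>.\<close>
      moreover have "\<not> T \<subseteq> W \<union> R" if "W \<subseteq> S" "W \<noteq> S"
        using that \<open>S \<subseteq> T\<close> \<open>R \<subseteq> pverts G - S\<close> by blast
      ultimately show "(- 1) ^ (card S - card W) * ?h (W \<union> R) = (if W = S then ?h (S \<union> R) else 0)"
        using that T h0[of "W \<union> R"] by auto
    qed
    also have "\<dots> = ?h (S \<union> R)"
      using finS by (simp add: sum.delta)
    finally show ?thesis .
  qed
  show ?thesis
  proof (cases "card S1 < k")
    case True
    have "?h S1 = ?h S2"
    proof (cases "S1 = T \<or> S2 = T")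
      case True
      then have "S1 = S2" using S finT card_subset_eq[OF finT] by metis
      then show ?thesis by simp
    next
      case False
      then have "\<not> T \<subseteq> S1" "\<not> T \<subseteq> S2" using S by auto
      then show ?thesis using h0 S T by auto
    qed
    then show ?thesis
      using True S deriv[of _ "{}"] by (simp add: myerson_taylor_low)
  next
    case False
    \<comment> \<open>In terms of \<open>X = S \<union> R\<close>, where \<open>card X - k\<close>
      recovers the size of \<open>R\<close>, the summand no longer mentions \<open>S\<close>. Sets
      \<open>X\<close> not containing \<open>S\<close> do not contain \<open>T\<close> and
      contribute zero, so the sum may run over all \<open>X\<close>.\<close>
    define F where "F = (\<lambda>X. beta_weight (card X - k) (card (pverts G) - 1 - (card X - k)) * ?h X)"
    have "myerson_taylor k S f G = real k * (\<Sum>X\<in>Pow (pverts G). F X)"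
      if S': "S \<subseteq> T" "card S = k" for S
    proof -
      have SV: "S \<subseteq> pverts G" using S' T by simp
      have finS: "finite S" using SV fin by (rule finite_subset)
      have "F (S \<union> R) = beta_weight (card R) (card (pverts G) - 1 - card R) * discrete_deriv S ?h R"
        if "R \<in> Pow (pverts G - S)" for R
      proof -
        have "card (S \<union> R) = k + card R"
          using that finS fin S' by (subst card_Un_disjoint) (auto intro: finite_subset)
        then show ?thesis using that S' by (simp add: F_def deriv)
      qed
      then have "myerson_taylor k S f G = real k * (\<Sum>R\<in>Pow (pverts G - S). F (S \<union> R))"
        by (simp add: myerson_taylor_top[OF fin SV S'(2) k])
      also have "\<dots> = real k * (\<Sum>X | S \<subseteq> X \<and> X \<subseteq> pverts G. F X)"
        by (simp add: sum_supersets[OF SV])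
      also have "(\<Sum>X | S \<subseteq> X \<and> X \<subseteq> pverts G. F X) = (\<Sum>X\<in>Pow (pverts G). F X)"
        using fin h0 S' by (intro sum.mono_neutral_left) (auto simp: F_def)
      finally show ?thesis .
    qed
    then show ?thesis using False S by simp
  qed
qed

lemma coalitional_fairness_myerson_taylor:
  assumes "1 \<le> k"
  shows "coalitional_fairness M k (myerson_taylor k)"
  unfolding coalitional_fairness_def
proof (intro allI impI ballI)
  fix G :: "'a pair_pre_digraph" and T S1 S2 and f1 f2 :: "'a set \<Rightarrow> real"
  assume *: "simple_graph G" "T \<subseteq> pverts G" "connected_in G T"
    "\<forall>R\<subseteq>pverts G. R \<noteq> T \<longrightarrow> f1 R = f2 R" "S1 \<subseteq> T" "S2 \<subseteq> T" "card S1 = card S2" "card S1 \<le> k"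
  have "myerson_taylor k S1 (\<lambda>T. f1 T + (- 1) * f2 T) G = myerson_taylor k S2 (\<lambda>T. f1 T + (- 1) * f2 T) G"
    by (rule myerson_taylor_single_coalition[OF *(1) assms *(2,3)]) (use * in auto)
  then show "myerson_taylor k S1 f1 G - myerson_taylor k S1 f2 G =
      myerson_taylor k S2 f1 G - myerson_taylor k S2 f2 G"
    unfolding myerson_taylor_linear by simp
qed

text \<open>No subset of \<open>S \<subset> T\<close> contains \<open>T\<close>, so the unanimity
  function vanishes on everything that enters the dividend of \<open>S\<close>.\<close>

lemma interaction_distribution_myerson_taylor: "interaction_distribution k (myerson_taylor k)"
  unfolding interaction_distribution_def
proof (intro allI impI)
  fix G :: "'a pair_pre_digraph" and T S
  assume *: "simple_graph G" "T \<subseteq> pverts G" "connected_in G T" "S \<subset> T" "card S < k"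
  have sym: "sym (parcs G)" using * by (simp add: simple_graph_def sym_parcs)
  have "restrict_fun G (unanimity T) W = restrict_fun G (\<lambda>_. 0) W" if "W \<subseteq> S" for W
    using * that by (intro restrict_fun_cong sym) (auto simp: unanimity_def)
  then have "discrete_deriv S (restrict_fun G (unanimity T)) {} = 0"
    by (simp add: discrete_deriv_def restrict_fun_def)
  then show "myerson_taylor k S (unanimity T) G = 0"
    using * by (simp add: myerson_taylor_low)
qed

text \<open>The restricted function is a function of \<open>W \<inter> C\<close> plus a function of
  \<open>W - C\<close>. The first ignores elements outside \<open>C\<close>, the second those of
  \<open>C\<close>; as \<open>T\<close> has elements of both kinds, both derivatives vanish.\<close>

lemma dividend_crossing_component:
  assumes sym: "sym (parcs G)" and fin: "finite (pverts G)" and C: "C \<in> components G (pverts G)"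
    and T: "T \<subseteq> pverts G" "T \<inter> C \<noteq> {}" "\<not> T \<subseteq> C"
  shows "discrete_deriv T (restrict_fun G f) {} = 0"
proof -
  let ?h = "restrict_fun G f"
  obtain i j where ij: "i \<in> T" "i \<in> C" "j \<in> T" "j \<notin> C" using T by blast
  have finT: "finite T" using T fin by (auto intro: finite_subset)
  have "discrete_deriv T ?h {} = discrete_deriv T (\<lambda>W. ?h (W \<inter> C) + 1 * ?h (W - C)) {}"
    using T restrict_fun_split_component[OF sym C fin]
    by (intro discrete_deriv_cong) (simp add: order_trans)
  also have "\<dots> = discrete_deriv T (\<lambda>W. ?h (W \<inter> C)) {} + 1 * discrete_deriv T (\<lambda>W. ?h (W - C)) {}"
    by (rule discrete_deriv_linear)
  also have "discrete_deriv T (\<lambda>W. ?h (W \<inter> C)) {} = 0"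
    using discrete_deriv_increment[OF finT ij(3), of "\<lambda>W. ?h (W \<inter> C)" 0] ij by (simp split: if_splits)
  also have "discrete_deriv T (\<lambda>W. ?h (W - C)) {} = 0"
    using discrete_deriv_increment[OF finT ij(1), of "\<lambda>W. ?h (W - C)" 0] ij by (simp split: if_splits)
  finally show ?thesis by simp
qed

text \<open>Double counting: the shares of each \<open>T \<subseteq> C\<close> with at least
  \<open>k\<close> elements go to \<open>card T choose k\<close> sets and recombine to its dividend.
  All dividends inside \<open>C\<close> then add up to \<open>f C\<close>, as \<open>C\<close> is
  connected.\<close>

lemma component_efficiency_myerson_taylor:
  assumes k: "1 \<le> k"
  shows "component_efficiency normalized k (myerson_taylor k)"
  unfolding component_efficiency_def
proof (intro allI impI ballI)
  fix G :: "'a pair_pre_digraph" and f :: "'a set \<Rightarrow> real" and C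
  assume G: "simple_graph G" and f: "f \<in> normalized" and C: "C \<in> components G (pverts G)"
  have sym: "sym (parcs G)" and fin: "finite (pverts G)"
    using G by (auto simp: simple_graph_def sym_parcs simple_graph_finite_pverts)
  have CV: "C \<subseteq> pverts G" by (rule component_subset[OF sym C])
  have finC: "finite C" using CV fin by (rule finite_subset)
  have finP: "finite {S. S \<subseteq> C \<and> P S}" for P
    using finC by (auto intro: finite_subset[of _ "Pow C"])
  define a where "a = (\<lambda>T. discrete_deriv T (restrict_fun G f) {})"
  have top: "myerson_taylor k S f G =
      (\<Sum>T | T \<in> {T. T \<subseteq> C \<and> k \<le> card T} \<and> S \<subseteq> T. a T / real (card T choose k))"
    if S: "S \<subseteq> C" "card S = k" for S
  proof -
    have "myerson_taylor k S f G =
        (\<Sum>T | S \<subseteq> T \<and> T \<subseteq> pverts G. a T / real (card T choose k))"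
      unfolding a_def using S CV by (intro myerson_taylor_top_dividends fin k) auto
    \<comment> \<open>A superset of \<open>S\<close> that is not inside \<open>C\<close> still meets
      \<open>C\<close>, as \<open>S\<close> is nonempty, so its dividend vanishes.\<close>
    also have "\<dots> = (\<Sum>T | T \<in> {T. T \<subseteq> C \<and> k \<le> card T} \<and> S \<subseteq> T. a T / real (card T choose k))"
    proof (rule sum.mono_neutral_right)
      show "\<forall>T\<in>{T. S \<subseteq> T \<and> T \<subseteq> pverts G} - {T. T \<in> {T. T \<subseteq> C \<and> k \<le> card T} \<and> S \<subseteq> T}.
          a T / real (card T choose k) = 0"
      proof
        fix T assume T: "T \<in> {T. S \<subseteq> T \<and> T \<subseteq> pverts G} - {T. T \<in> {T. T \<subseteq> C \<and> k \<le> card T} \<and> S \<subseteq> T}"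
        then have "k \<le> card T"
          using S fin by (metis (no_types, lifting) CollectD DiffD1 card_mono finite_subset)
        moreover have "T \<inter> C \<noteq> {}"
        proof -
          have "S \<noteq> {}" using S k by auto
          then show ?thesis using T S by blast
        qed
        ultimately show "a T / real (card T choose k) = 0"
          using T dividend_crossing_component[OF sym fin C, of T f] by (auto simp: a_def)
      qed
    qed (use fin CV in \<open>auto intro: finite_subset[of _ "Pow (pverts G)"]\<close>)
    finally show ?thesis .
  qed
  have "(\<Sum>S | S \<subseteq> C \<and> card S = k. myerson_taylor k S f G) =
      (\<Sum>S\<in>{S. S \<subseteq> C \<and> card S = k}.
        \<Sum>T | T \<in> {T. T \<subseteq> C \<and> k \<le> card T} \<and> S \<subseteq> T. a T / real (card T choose k))"
    by (intro sum.cong) (auto simp: top)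
  also have "\<dots> = (\<Sum>T\<in>{T. T \<subseteq> C \<and> k \<le> card T}.
      \<Sum>S | S \<in> {S. S \<subseteq> C \<and> card S = k} \<and> S \<subseteq> T. a T / real (card T choose k))"
    by (rule sum.swap_restrict) (auto intro: finP)
  also have "\<dots> = (\<Sum>T | T \<subseteq> C \<and> k \<le> card T. a T)"
  proof (rule sum.cong)
    fix T assume T: "T \<in> {T. T \<subseteq> C \<and> k \<le> card T}"
    then have "{S. S \<in> {S. S \<subseteq> C \<and> card S = k} \<and> S \<subseteq> T} = {S. S \<subseteq> T \<and> card S = k}" by auto
    moreover have "card {S. S \<subseteq> T \<and> card S = k} = card T choose k"
      using T finC by (intro n_subsets) (auto intro: finite_subset)
    ultimately show "(\<Sum>S | S \<in> {S. S \<subseteq> C \<and> card S = k} \<and> S \<subseteq> T. a T / real (card T choose k)) = a T"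
      using T by simp
  qed simp
  finally have eq: "(\<Sum>S | S \<subseteq> C \<and> card S = k. myerson_taylor k S f G) =
      (\<Sum>T | T \<subseteq> C \<and> k \<le> card T. a T)" .
  have "{S. S \<subseteq> C \<and> card S \<le> k} = {S. S \<subseteq> C \<and> card S < k} \<union> {S. S \<subseteq> C \<and> card S = k}" by auto
  then have "(\<Sum>S | S \<subseteq> C \<and> card S \<le> k. myerson_taylor k S f G) =
      (\<Sum>S | S \<subseteq> C \<and> card S < k. myerson_taylor k S f G) +
      (\<Sum>S | S \<subseteq> C \<and> card S = k. myerson_taylor k S f G)"
    by (simp only:) (rule sum.union_disjoint, auto intro: finP)
  also have "\<dots> = (\<Sum>S | S \<subseteq> C \<and> card S < k. a S) + (\<Sum>S | S \<subseteq> C \<and> k \<le> card S. a S)"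
    unfolding eq by (simp add: myerson_taylor_low a_def)
  also have "\<dots> = (\<Sum>S\<in>Pow C. a S)"
    by (subst sum.union_disjoint[symmetric]) (auto intro: finP sum.cong)
  also have "\<dots> = f C"
    unfolding a_def sum_discrete_deriv[OF finC]
    by (rule restrict_fun_connected[OF sym component_connected[OF sym C]])
  finally show "(\<Sum>S | S \<subseteq> C \<and> card S \<le> k. myerson_taylor k S f G) = f C - f {}"
    using f by (simp add: normalized_def)
qed

lemma satisfies_axioms_myerson_taylor:
  "1 \<le> k \<Longrightarrow> satisfies_axioms normalized k (myerson_taylor k)"
  by (simp add: satisfies_axioms_def interaction_index_myerson_taylor linearity_myerson_taylor
      restricted_null_player_axiom_myerson_taylor coalitional_fairness_myerson_taylor
      interaction_distribution_myerson_taylor component_efficiency_myerson_taylor)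

section \<open>Uniqueness\<close>

text \<open>Components and singletons are connected, so every term of the null player condition is
  zero.\<close>

lemma vanishes_null_player:
  assumes sym: "sym (parcs G)" and f: "\<And>T. \<lbrakk>T \<subseteq> pverts G; connected_in G T\<rbrakk> \<Longrightarrow> f T = 0"
    and i: "i \<in> pverts G"
  shows "restricted_null_player G f i"
proof -
  have "(\<Sum>R\<in>components G T. f R) = 0" if "T \<subseteq> pverts G - {i}" for T
    using that component_subset[OF sym, of _ T] component_connected[OF sym, of _ T] f
    by (intro sum.neutral) blast
  moreover have "f {i} = 0"
    using f connected_in_singleton[OF sym] i by simp
  moreover have "f (insert i T) = 0" if "T \<subseteq> pverts G - {i}" "connected_in G (insert i T)" for T
    using that i by (intro f) auto
  ultimately show ?thesis
    using i by (simp add: restricted_null_player_def)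
qed

text \<open>If the connected set \<open>T\<close> lies in \<open>U\<close>, it lies in exactly one
  component of \<open>U\<close>; adding \<open>i\<close> outside \<open>T\<close> does not affect
  whether \<open>T\<close> is contained.\<close>

lemma unanimity_null_player:
  assumes sym: "sym (parcs G)" and fin: "finite (pverts G)"
    and T: "connected_in G T" and i: "i \<in> pverts G" "i \<notin> T"
  shows "restricted_null_player G (unanimity T) i"
proof -
  have "(\<Sum>R\<in>components G U. unanimity T R) = unanimity T (insert i U)"
    if U: "U \<subseteq> pverts G - {i}" for U
  proof (cases "T \<subseteq> U")
    case True
    then obtain R where R: "R \<in> components G U" "T \<subseteq> R"
      using connected_in_subset_component[OF sym T] by blast
    have "unanimity T R' = (if R' = R then 1 else 0)" if "R' \<in> components G U" for R'
      using components_disjoint[OF sym that R(1)] R(2) connected_in_nonempty[OF sym T]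
      by (auto simp: unanimity_def)
    moreover have "finite (components G U)"
      using U fin by (intro finite_components[OF sym]) (auto intro: finite_subset)
    ultimately show ?thesis
      using R(1) True by (simp add: sum.delta subset_insertI2) (simp add: unanimity_def subset_insertI2)
  next
    case False
    have "unanimity T R = 0" if "R \<in> components G U" for R
      using component_subset[OF sym that] False by (auto simp: unanimity_def)
    then show ?thesis
      using False i by (simp add: unanimity_def subset_insert)
  qed
  moreover have "unanimity T {i} = 0"
    using i connected_in_nonempty[OF sym T] by (auto simp: unanimity_def)
  ultimately show ?thesis
    using i by (simp add: restricted_null_player_def)
qed

lemma restricted_null_player_axiomD:
  assumes "restricted_null_player_axiom M k I" "simple_graph G" "f \<in> M"
    "restricted_null_player G f i" "S \<subseteq> pverts G" "i \<in> S" "card S \<le> k"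
  shows "I S f G = (if S = {i} then f {i} else 0)"
proof -
  have "S = insert i (S - {i})" "S - {i} \<subseteq> pverts G - {i}" using assms by auto
  moreover have "S - {i} \<noteq> {}" if "S \<noteq> {i}" using assms that by auto
  ultimately show ?thesis
    using assms unfolding restricted_null_player_axiom_def by metis
qed

lemma coalitional_fairnessD:
  assumes fair: "coalitional_fairness M k I" and "simple_graph G" "T \<subseteq> pverts G" "connected_in G T"
    "f \<in> M" "g \<in> M" "\<forall>R\<subseteq>pverts G. R \<noteq> T \<longrightarrow> f R = g R"
    "S1 \<subseteq> T" "S2 \<subseteq> T" "card S1 = card S2" "card S1 \<le> k"
  shows "I S1 f G - I S1 g G = I S2 f G - I S2 g G"
  by (rule fair[unfolded coalitional_fairness_def, rule_format, of G T])
    (use assms in \<open>auto\<close>)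

text \<open>
  The difference of two indices is again linear and fair, and it sums to zero over each component.
\<close>

lemma index_difference_eq_zero:
  fixes D :: "'a set \<Rightarrow> ('a set \<Rightarrow> real) \<Rightarrow> real"
  assumes G: "simple_graph G" and k: "1 \<le> k"
    and lin: "\<And>f g \<alpha> S. \<lbrakk>f {} = 0; g {} = 0; S \<subseteq> pverts G; card S \<le> k\<rbrakk> \<Longrightarrow>
      D S (\<lambda>T. f T + \<alpha> * g T) = D S f + \<alpha> * D S g"
    and null: "\<And>f i S. \<lbrakk>f {} = 0; restricted_null_player G f i; S \<subseteq> pverts G; i \<in> S; card S \<le> k\<rbrakk> \<Longrightarrow>
      D S f = 0"
    and fair: "\<And>f T S1 S2. \<lbrakk>T \<subseteq> pverts G; connected_in G T; f {} = 0;
      \<forall>R\<subseteq>pverts G. R \<noteq> T \<longrightarrow> f R = 0; S1 \<subseteq> T; S2 \<subseteq> T; card S1 = card S2; card S1 \<le> k\<rbrakk> \<Longrightarrow>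
      D S1 f = D S2 f"
    and dist: "\<And>T S. \<lbrakk>T \<subseteq> pverts G; connected_in G T; S \<subset> T; card S < k\<rbrakk> \<Longrightarrow> D S (unanimity T) = 0"
    and eff: "\<And>f C. \<lbrakk>f {} = 0; C \<in> components G (pverts G)\<rbrakk> \<Longrightarrow>
      (\<Sum>S | S \<subseteq> C \<and> card S \<le> k. D S f) = 0"
    and f: "f {} = 0" and S: "S \<subseteq> pverts G" "card S \<le> k"
  shows "D S f = 0"
proof -
  have sym: "sym (parcs G)" and fin: "finite (pverts G)" and ne: "pverts G \<noteq> {}"
    using G by (auto simp: simple_graph_def sym_parcs simple_graph_finite_pverts)
  have finS: "finite S" if "S \<subseteq> pverts G" for S
    using that fin by (rule finite_subset)
  \<comment> \<open>Every vertex is null, which settles nonempty \<open>S\<close>. For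
    \<open>S = {}\<close>, efficiency on some component leaves \<open>D {} f\<close> as the only
    term.\<close>
  have vanish: "D S f = 0" if f: "f {} = 0" "\<And>T. \<lbrakk>T \<subseteq> pverts G; connected_in G T\<rbrakk> \<Longrightarrow> f T = 0"
    and S: "S \<subseteq> pverts G" "card S \<le> k" for f S
  proof -
    have nonempty: "D S f = 0" if S: "S \<subseteq> pverts G" "card S \<le> k" "S \<noteq> {}" for S
    proof -
      obtain i where i: "i \<in> S" using S by blast
      then have "restricted_null_player G f i"
        using S f by (intro vanishes_null_player sym) auto
      then show ?thesis using null i S f by blast
    qed
    obtain C where C: "C \<in> components G (pverts G)"
      using Union_components[OF sym, of "pverts G"] ne by blast
    have CV: "C \<subseteq> pverts G" by (rule component_subset[OF sym C])
    have "(\<Sum>S | S \<subseteq> C \<and> card S \<le> k. D S f) = (\<Sum>S\<in>{{}}. D S f)"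
      using CV nonempty finS[OF CV]
      by (intro sum.mono_neutral_right) (auto intro: finite_subset[of _ "Pow C"])
    then have "D {} f = 0" using eff[of f, OF f(1) C] by simp
    then show ?thesis using nonempty S by blast
  qed
  have agree: "D S f = D S g" if "f {} = 0" "g {} = 0" "S \<subseteq> pverts G" "card S \<le> k"
    "\<And>T. \<lbrakk>T \<subseteq> pverts G; connected_in G T\<rbrakk> \<Longrightarrow> f T = g T" for f g S
    using vanish[of "\<lambda>T. f T + (- 1) * g T" S] lin[of f g S "- 1"] that by simp
  define e where "e = (\<lambda>T R :: 'a set. if R = T then 1 else 0 :: real)"
  define \<C> where "\<C> = {T. T \<subseteq> pverts G \<and> connected_in G T}"
  have fin\<C>: "finite \<C>" using fin by (auto simp: \<C>_def intro: finite_subset[of _ "Pow (pverts G)"])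
  have e0: "e T {} = 0" if "T \<in> \<C>" for T
    using that connected_in_nonempty[OF sym] by (auto simp: e_def \<C>_def)
  have combine: "D S (\<lambda>R. \<Sum>T\<in>A. c T * e T R) = (\<Sum>T\<in>A. c T * D S (e T))"
    if "finite A" "A \<subseteq> \<C>" "S \<subseteq> pverts G" "card S \<le> k" for A c S
    using that(1,2)
  proof (induction A rule: finite_induct)
    case empty
    then show ?case using vanish[of "\<lambda>_. 0" S] that by simp
  next
    case (insert T A)
    have "(\<Sum>T\<in>A. c T * e T {}) = 0" "e T {} = 0"
      using insert.prems e0 by (auto intro!: sum.neutral)
    then have "D S (\<lambda>R. (\<Sum>T\<in>A. c T * e T R) + c T * e T R) =
        D S (\<lambda>R. \<Sum>T\<in>A. c T * e T R) + c T * D S (e T)"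
      using that by (intro lin)
    then show ?case using insert by (simp add: add.commute)
  qed
  have basis: "D S (e T) = 0" if "T \<in> \<C>" "S \<subseteq> pverts G" "card S \<le> k" for T S
    using that
  proof (induction "card (pverts G) - card T" arbitrary: T S rule: less_induct)
    \<comment> \<open>The induction is on the number of vertices outside \<open>T\<close>, so the
      hypothesis covers the connected sets with more elements than \<open>T\<close>.\<close>
    case less
    have TV: "T \<subseteq> pverts G" and con: "connected_in G T" using less.prems by (auto simp: \<C>_def)
    have Tne: "T \<noteq> {}" by (rule connected_in_nonempty[OF sym con])
    have u0: "unanimity T {} = 0" using Tne by (auto simp: unanimity_def)
    \<comment> \<open>On connected sets, \<open>unanimity T\<close> is the sum of the indicators of
      the connected supersets of \<open>T\<close>; all except that of \<open>T\<close> are covered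
      by the induction hypothesis.\<close>
    have shift: "D S (unanimity T) = D S (e T)" if S: "S \<subseteq> pverts G" "card S \<le> k" for S
    proof -
      let ?A = "{R \<in> \<C>. T \<subseteq> R}"
      have finA: "finite ?A" using fin\<C> by simp
      have "D S (unanimity T) = D S (\<lambda>R. \<Sum>X\<in>?A. 1 * e X R)"
      proof (rule agree)
        show "(\<Sum>X\<in>?A. 1 * e X {}) = 0" using e0 by (intro sum.neutral) auto
        fix R assume "R \<subseteq> pverts G" "connected_in G R"
        then have "R \<in> \<C>" by (simp add: \<C>_def)
        have "(\<Sum>X\<in>?A. 1 * e X R) = (\<Sum>X\<in>?A. if R = X then 1 else 0)"
          by (simp add: e_def)
        also have "\<dots> = unanimity T R"
          using finA \<open>R \<in> \<C>\<close> by (simp add: sum.delta' unanimity_def)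
        finally show "unanimity T R = (\<Sum>X\<in>?A. 1 * e X R)" by simp
      qed (use u0 S in simp_all)
      also have "\<dots> = (\<Sum>X\<in>?A. 1 * D S (e X))"
        using S finA by (intro combine) auto
      also have "\<dots> = (\<Sum>X\<in>?A. if X = T then D S (e T) else 0)"
      proof (rule sum.cong[OF refl])
        fix X assume X: "X \<in> ?A"
        then have XV: "X \<subseteq> pverts G" by (simp add: \<C>_def)
        have "D S (e X) = 0" if "X \<noteq> T"
        proof (rule less.hyps)
          have "card T < card X"
            using X that finS[OF XV] by (intro psubset_card_mono) auto
          moreover have "card X \<le> card (pverts G)"
            using XV fin by (intro card_mono)
          ultimately show "card (pverts G) - card X < card (pverts G) - card T" by simp
        qed (use X S in auto)
        then show "1 * D S (e X) = (if X = T then D S (e T) else 0)" by simp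
      qed
      also have "\<dots> = D S (e T)"
        using finA less.prems(1) by (simp add: sum.delta)
      finally show ?thesis .
    qed
    have outside: "D S (unanimity T) = 0" if S: "S \<subseteq> pverts G" "card S \<le> k" "\<not> S \<subseteq> T" for S
    proof -
      obtain i where "i \<in> S" "i \<notin> T" using S by blast
      then show ?thesis
        using S null[of "unanimity T" i S] u0 unanimity_null_player[OF sym fin con, of i] by auto
    qed
    obtain C where C: "C \<in> components G (pverts G)" "T \<subseteq> C"
      using connected_in_subset_component[OF sym con TV] by blast
    have CV: "C \<subseteq> pverts G" by (rule component_subset[OF sym C(1)])
    have finC: "finite {S. S \<subseteq> C \<and> P S}" for P
      using finS[OF CV] by (auto intro: finite_subset[of _ "Pow C"])
    \<comment> \<open>If \<open>T\<close> has fewer than \<open>k\<close> elements, the largest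
      admissible subset is \<open>T\<close> itself; otherwise these are the subsets of size
      \<open>k\<close>.\<close>
    define m where "m = min k (card T)"
    text \<open>By distribution, only the largest admissible subsets of \<open>T\<close> can contribute.\<close>
    have small: "D S (unanimity T) = 0" if S: "S \<subseteq> T" "card S \<le> k" "card S \<noteq> m" for S
    proof -
      have "card S \<le> card T" using S finS[OF TV] by (intro card_mono)
      then have "card S < k" "S \<noteq> T" using S by (auto simp: m_def)
      then show ?thesis using S by (intro dist TV con) auto
    qed
    obtain S0 where S0: "S0 \<subseteq> T" "card S0 = m"
      using obtain_subset_with_card_n[of m T] by (auto simp: m_def)
    have equal: "D S (unanimity T) = D S0 (unanimity T)" if "S \<subseteq> T" "card S = m" for S
    proof -
      \<comment> \<open>\<open>fair\<close> asks for a function that vanishes off \<open>T\<close>,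
        so it is applied to the indicator, and \<open>shift\<close> carries the result over.\<close>
      have "D S (e T) = D S0 (e T)"
        using that S0 e0 less.prems by (intro fair[OF TV con]) (auto simp: e_def m_def)
      then show ?thesis
        using that S0 TV shift by (simp add: m_def)
    qed
    have "0 = (\<Sum>S | S \<subseteq> C \<and> card S \<le> k. D S (unanimity T))"
      by (rule eff[of "unanimity T", OF u0 C(1), symmetric])
    also have "\<dots> = (\<Sum>S | S \<subseteq> T \<and> card S = m. D S (unanimity T))"
    proof (rule sum.mono_neutral_right[OF finC])
      show "{S. S \<subseteq> T \<and> card S = m} \<subseteq> {S. S \<subseteq> C \<and> card S \<le> k}"
        using C by (auto simp: m_def)
      show "\<forall>S\<in>{S. S \<subseteq> C \<and> card S \<le> k} - {S. S \<subseteq> T \<and> card S = m}. D S (unanimity T) = 0"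
        using CV small outside by blast
    qed
    also have "\<dots> = (\<Sum>S | S \<subseteq> T \<and> card S = m. D S0 (unanimity T))"
      by (intro sum.cong) (auto intro: equal)
    also have "\<dots> = real (card T choose m) * D S0 (unanimity T)"
      using n_subsets[OF finS[OF TV], of m] by simp
    finally have "D S0 (unanimity T) = 0"
      by (simp add: m_def)
    then have "D S (unanimity T) = 0"
      using less.prems outside small equal by metis
    then show ?case using shift less.prems by simp
  qed
  have "D S f = D S (\<lambda>R. \<Sum>T\<in>\<C>. f T * e T R)"
  proof (rule agree)
    show "(\<Sum>T\<in>\<C>. f T * e T {}) = 0" using e0 by (intro sum.neutral) auto
    fix R assume "R \<subseteq> pverts G" "connected_in G R"
    then have "R \<in> \<C>" by (simp add: \<C>_def)
    then show "f R = (\<Sum>T\<in>\<C>. f T * e T R)"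
      using fin\<C> by (simp add: e_def if_distrib[of "(*) _"] cong: if_cong)
  qed (use f S in simp_all)
  also have "\<dots> = (\<Sum>T\<in>\<C>. f T * D S (e T))"
    using S fin\<C> by (intro combine) auto
  also have "\<dots> = 0"
    using S by (simp add: basis)
  finally show ?thesis .
qed

section \<open>From differences of indices to the characterization\<close>

lemma satisfies_axioms_unique:
  fixes I J :: "'a index"
  assumes k: "1 \<le> k" and I: "satisfies_axioms normalized k I" and J: "satisfies_axioms normalized k J"
    and G: "simple_graph G" and f: "f \<in> normalized" and S: "S \<subseteq> pverts G" "card S \<le> k"
  shows "I S f G = J S f G"
proof -
  have "I S f G - J S f G = 0"
  proof (rule index_difference_eq_zero[OF G k, where D = "\<lambda>S f. I S f G - J S f G"])
    fix f g :: "'a set \<Rightarrow> real" and \<alpha> S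
    assume "f {} = 0" "g {} = 0" "S \<subseteq> pverts G" "card S \<le> k"
    then show "I S (\<lambda>T. f T + \<alpha> * g T) G - J S (\<lambda>T. f T + \<alpha> * g T) G =
        I S f G - J S f G + \<alpha> * (I S g G - J S g G)"
      using I J G by (simp add: satisfies_axioms_def linearity_def normalized_def algebra_simps)
  next
    fix f :: "'a set \<Rightarrow> real" and i S
    assume "f {} = 0" "restricted_null_player G f i" "S \<subseteq> pverts G" "i \<in> S" "card S \<le> k"
    then have "K S f G = (if S = {i} then f {i} else 0)"
      if "satisfies_axioms normalized k K" for K :: "'a index"
      using that G by (intro restricted_null_player_axiomD) (auto simp: satisfies_axioms_def normalized_def)
    from this[OF I] this[OF J] show "I S f G - J S f G = 0"
      by simp
  next
    fix f :: "'a set \<Rightarrow> real" and T S1 S2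
    assume *: "T \<subseteq> pverts G" "connected_in G T" "f {} = 0" "\<forall>R\<subseteq>pverts G. R \<noteq> T \<longrightarrow> f R = 0"
      "S1 \<subseteq> T" "S2 \<subseteq> T" "card S1 = card S2" "card S1 \<le> k"
    have fair: "K S1 f G - K S1 (\<lambda>_. 0) G = K S2 f G - K S2 (\<lambda>_. 0) G"
      if "satisfies_axioms normalized k K" for K
    proof -
      have "coalitional_fairness normalized k K" "f \<in> normalized" "(\<lambda>_. 0) \<in> normalized"
        using that * by (auto simp: satisfies_axioms_def normalized_def)
      then show ?thesis
        using G * by (intro coalitional_fairnessD[of normalized k K G T f "\<lambda>_. 0"]) auto
    qed
    \<comment> \<open>Fairness compares two functions. Taking the zero function as the second one
      works because linearity, with both functions zero and coefficient one, makes an index vanish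
      there.\<close>
    have zero: "K S (\<lambda>_. 0) G = 0"
      if "satisfies_axioms normalized k K" "S \<subseteq> pverts G" "card S \<le> k" for K S
    proof -
      have "linearity normalized k K" "(\<lambda>_. 0) \<in> normalized"
        using that by (auto simp: satisfies_axioms_def normalized_def)
      then have "K S (\<lambda>_. 0 + 1 * 0) G = K S (\<lambda>_. 0) G + 1 * K S (\<lambda>_. 0) G"
        by (rule linearity_def[THEN iffD1, rule_format, OF _ G]) (use that in \<open>simp_all add: normalized_def\<close>)
      then show ?thesis by simp
    qed
    have "S1 \<subseteq> pverts G" "S2 \<subseteq> pverts G" "card S2 \<le> k" using * by auto
    then show "I S1 f G - J S1 f G = I S2 f G - J S2 f G"
      using fair[OF I] fair[OF J] zero[OF I] zero[OF J] * by simp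
  next
    fix T S assume "T \<subseteq> pverts G" "connected_in G T" "S \<subset> T" "card S < k"
    then show "I S (unanimity T) G - J S (unanimity T) G = 0"
      using I J G by (simp add: satisfies_axioms_def interaction_distribution_def)
  next
    fix f :: "'a set \<Rightarrow> real" and C assume "f {} = 0" "C \<in> components G (pverts G)"
    then show "(\<Sum>S | S \<subseteq> C \<and> card S \<le> k. I S f G - J S f G) = 0"
      using I J G by (simp add: satisfies_axioms_def component_efficiency_def normalized_def
          sum_subtractf)
  qed (use f S in \<open>simp_all add: normalized_def\<close>)
  then show ?thesis by simp
qed

text \<open>The axioms get weaker on a smaller class of functions; this lets an index for arbitrary
  functions be compared on \<open>normalized\<close>.\<close>

lemma satisfies_axioms_mono:
  assumes "M \<subseteq> N" "satisfies_axioms N k I"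
  shows "satisfies_axioms M k (I :: 'a index)"
proof -
  have "interaction_index M k I" "linearity M k I" "restricted_null_player_axiom M k I"
    "component_efficiency M k I" "interaction_distribution k I"
    using assms
    by (simp_all add: satisfies_axioms_def interaction_index_def linearity_def
        restricted_null_player_axiom_def component_efficiency_def subset_eq)
  moreover have "coalitional_fairness M k I"
    unfolding coalitional_fairness_def
  proof (intro allI impI ballI)
    fix G :: "'a pair_pre_digraph" and T S1 S2 and f1 f2 :: "'a set \<Rightarrow> real"
    assume *: "simple_graph G" "T \<subseteq> pverts G" "connected_in G T" "f1 \<in> M" "f2 \<in> M"
      "\<forall>R\<subseteq>pverts G. R \<noteq> T \<longrightarrow> f1 R = f2 R" "S1 \<subseteq> T" "S2 \<subseteq> T" "card S1 = card S2" "card S1 \<le> k"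
    have "coalitional_fairness N k I" using assms(2) by (simp add: satisfies_axioms_def)
    then show "I S1 f1 G - I S1 f2 G = I S2 f1 G - I S2 f2 G"
      using * assms(1) by (intro coalitional_fairnessD[of N k I G T f1 f2]) auto
  qed
  ultimately show ?thesis by (simp add: satisfies_axioms_def)
qed

text \<open>Every vertex is a null player of the indicator function of the empty set.\<close>

lemma index_indep_empty:
  assumes I: "linearity UNIV k I" "restricted_null_player_axiom UNIV k I"
    and G: "simple_graph G" and S: "S \<subseteq> pverts G" "card S \<le> k" "S \<noteq> {}"
  shows "I S (f({} := 0)) G = I S f G"
proof -
  have sym: "sym (parcs G)" using G by (simp add: simple_graph_def sym_parcs)
  let ?e = "\<lambda>T :: 'a set. if T = {} then 1 else 0 :: real"
  obtain i where i: "i \<in> S" using S by blast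
  have "restricted_null_player G ?e i"
    using i S connected_in_nonempty[OF sym] by (intro vanishes_null_player sym) auto
  then have "I S ?e G = 0"
    using restricted_null_player_axiomD[OF I(2) G UNIV_I _ S(1) i S(2)] by simp
  moreover have "I S (\<lambda>T. f T + (- f {}) * ?e T) G = I S f G + (- f {}) * I S ?e G"
    by (rule I(1)[unfolded linearity_def, rule_format, OF G UNIV_I UNIV_I S(1,2)])
  \<comment> \<open>Resetting the value at \<open>{}\<close> amounts to subtracting a multiple of
    the indicator.\<close>
  moreover have "(\<lambda>T. f T + (- f {}) * ?e T) = f({} := 0)" by auto
  ultimately show ?thesis by (simp only: mult_zero_right add_0_right)
qed

text \<open>The Myerson-Taylor index ignores \<open>f {}\<close>, hence the full characterization on
  \<open>normalized\<close>. For arbitrary functions uniqueness leaves out \<open>S = {}\<close>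
  with \<open>f {} \<noteq> 0\<close>, where the axioms force a dependence on
  \<open>f {}\<close>.\<close>

theorem theorem5p1:
  fixes k :: nat
  assumes "1 \<le> k"
  shows
    "(satisfies_axioms normalized k (myerson_taylor k :: 'a index) \<and>
      (\<forall>I :: 'a index. satisfies_axioms normalized k I \<longrightarrow>
        (\<forall>G f S. simple_graph G \<longrightarrow> f \<in> normalized \<longrightarrow> S \<subseteq> pverts G \<longrightarrow> card S \<le> k \<longrightarrow>
          I S f G = myerson_taylor k S f G)))
     \<and>
     (interaction_index UNIV k (myerson_taylor k :: 'a index) \<and>
      linearity UNIV k (myerson_taylor k :: 'a index) \<and>
      restricted_null_player_axiom UNIV k (myerson_taylor k :: 'a index) \<and>
      coalitional_fairness UNIV k (myerson_taylor k :: 'a index) \<and>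
      (\<forall>I :: 'a index. satisfies_axioms UNIV k I \<longrightarrow>
        (\<forall>G f S. simple_graph G \<longrightarrow> S \<subseteq> pverts G \<longrightarrow> card S \<le> k \<longrightarrow>
          S \<noteq> {} \<or> f {} = 0 \<longrightarrow> I S f G = myerson_taylor k S f G)))"
proof (intro conjI allI impI)
  show "satisfies_axioms normalized k (myerson_taylor k :: 'a index)"
    by (rule satisfies_axioms_myerson_taylor[OF assms])
  show "I S f G = myerson_taylor k S f G"
    if "satisfies_axioms normalized k I" "simple_graph G" "f \<in> normalized" "S \<subseteq> pverts G"
      "card S \<le> k" for I :: "'a index" and G :: "'a pair_pre_digraph"
      and f :: "'a set \<Rightarrow> real" and S :: "'a set"
    using satisfies_axioms_unique[OF assms that(1) satisfies_axioms_myerson_taylor[OF assms]] that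
    by blast
  note unique = this
  show "interaction_index UNIV k (myerson_taylor k :: 'a index)"
    by (rule interaction_index_myerson_taylor)
  show lin: "linearity UNIV k (myerson_taylor k :: 'a index)"
    by (rule linearity_myerson_taylor)
  show null: "restricted_null_player_axiom UNIV k (myerson_taylor k :: 'a index)"
    by (rule restricted_null_player_axiom_myerson_taylor[OF assms])
  show "coalitional_fairness UNIV k (myerson_taylor k :: 'a index)"
    by (rule coalitional_fairness_myerson_taylor[OF assms])
  fix I :: "'a index" and G :: "'a pair_pre_digraph" and f :: "'a set \<Rightarrow> real" and S :: "'a set"
  assume I: "satisfies_axioms UNIV k I" and G: "simple_graph G"
    and S: "S \<subseteq> pverts G" "card S \<le> k" and f: "S \<noteq> {} \<or> f {} = 0"
  have eq: "I S g G = myerson_taylor k S g G" if "g {} = 0" for g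
    using unique[OF satisfies_axioms_mono[OF subset_UNIV I] G _ S] that by (simp add: normalized_def)
  show "I S f G = myerson_taylor k S f G"
  proof (cases "f {} = 0")
    \<comment> \<open>At a nonempty \<open>S\<close> neither index changes when \<open>f {}\<close>
      is reset to zero, which reduces the claim to a normalized function.\<close>
    case False
    then have "S \<noteq> {}" using f by simp
    note indep = index_indep_empty[OF _ _ G S this, of _ f]
    have "I S (f({} := 0)) G = I S f G"
      using I by (intro indep) (simp_all add: satisfies_axioms_def)
    moreover have "myerson_taylor k S (f({} := 0)) G = myerson_taylor k S f G"
      by (rule indep[OF lin null])
    ultimately show ?thesis using eq[of "f({} := 0)"] by simp
  qed (rule eq)
qed

end
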